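(* Let $H$ be the three-dimensional Heisenberg group. Then the sequence $c_{\leq n}(H(\mathbb{Z}),H(\mathbb{R}))$ grows cubically; more precisely, $$\lim_{n\to\infty}\frac{c_{\leq n}(H(\mathbb{Z}),H(\mathbb{R}))}{n^3}=\frac{1}{3\zeta(3)},$$ where $\zeta$ is the Riemann zeta function.
   Context: For a commutative ring $S$, $H(S)$ is the group of upper unitriangular $3\times 3$ matrices with entries in $S$. For a group $G$, a subgroup $A\subset G$ and $g\in G$, write $A^g=g^{-1}Ag$. The commensurizer $\mathrm{Comm}(A,G)$ is the set of $g\in G$ such that $A\cap A^g$ has finite index in both $A$ and $A^g$. For a positive integer $n$, $\mathrm{Comm}_n(A,G)=\{g\in \mathrm{Comm}(A,G): [A:A\cap A^g]=n\}$. The normalizer $N_G(A)$ acts on $\mathrm{Comm}_n(A,G)$ by left multiplication, and $c_n(A,G)=|N_G(A)\backslash \mathrm{Comm}_n(A,G)|$. Finally $c_{\leq n}(A,G)=c_1(A,G)+\dots+c_n(A,G)$. *)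

theory Defs
  imports "HOL-Analysis.Analysis" "HOL-Algebra.Group_Action"
begin

(* The index type 3 satisfies 3 = 0 and its order is not 1 < 2 < 3, so the entries are listed. *)
definition heisenberg :: "('a::comm_ring_1 ^ 3 ^ 3) monoid" where
  "heisenberg =
     \<lparr> carrier = {M. M $ 1 $ 1 = 1 \<and> M $ 2 $ 2 = 1 \<and> M $ 3 $ 3 = 1 \<and>
                     M $ 2 $ 1 = 0 \<and> M $ 3 $ 1 = 0 \<and> M $ 3 $ 2 = 0},
       mult = (**),
       one = mat 1 \<rparr>"

(* H(Z), viewed inside H(R) through the inclusion of Z in R. *)
definition heisenberg_int :: "(real ^ 3 ^ 3) set" where
  "heisenberg_int = map_matrix of_int ` carrier (heisenberg :: (int ^ 3 ^ 3) monoid)"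

definition conj_set :: "('g, 'x) monoid_scheme \<Rightarrow> 'g set \<Rightarrow> 'g \<Rightarrow> 'g set" where
  "conj_set G A g = (inv\<^bsub>G\<^esub> g) <#\<^bsub>G\<^esub> A #>\<^bsub>G\<^esub> g"

definition has_finite_index :: "('g, 'x) monoid_scheme \<Rightarrow> 'g set \<Rightarrow> 'g set \<Rightarrow> bool" where
  "has_finite_index G A B \<longleftrightarrow> finite (rcosets\<^bsub>G\<lparr>carrier := A\<rparr>\<^esub> B)"

(* The index [A : B]; the value is 0 if the index is infinite. *)
definition subgroup_index :: "('g, 'x) monoid_scheme \<Rightarrow> 'g set \<Rightarrow> 'g set \<Rightarrow> nat" where
  "subgroup_index G A B = card (rcosets\<^bsub>G\<lparr>carrier := A\<rparr>\<^esub> B)"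

definition commensurizer :: "'g set \<Rightarrow> ('g, 'x) monoid_scheme \<Rightarrow> 'g set" where
  "commensurizer A G =
     {g \<in> carrier G. has_finite_index G A (A \<inter> conj_set G A g) \<and>
                     has_finite_index G (conj_set G A g) (A \<inter> conj_set G A g)}"

definition commensurizer_index :: "nat \<Rightarrow> 'g set \<Rightarrow> ('g, 'x) monoid_scheme \<Rightarrow> 'g set" where
  "commensurizer_index n A G =
     {g \<in> commensurizer A G. subgroup_index G A (A \<inter> conj_set G A g) = n}"

definition comm_quotient :: "nat \<Rightarrow> 'g set \<Rightarrow> ('g, 'x) monoid_scheme \<Rightarrow> 'g set set" where
  "comm_quotient n A G =
     orbits (G\<lparr>carrier := normalizer G A\<rparr>) (commensurizer_index n A G) (\<lambda>h g. h \<otimes>\<^bsub>G\<^esub> g)"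

(* c_n(A,G), meaningful when the quotient is finite: card is 0 on infinite sets. *)
definition comm_count :: "nat \<Rightarrow> 'g set \<Rightarrow> ('g, 'x) monoid_scheme \<Rightarrow> nat" where
  "comm_count n A G = card (comm_quotient n A G)"

definition comm_count_upto :: "nat \<Rightarrow> 'g set \<Rightarrow> ('g, 'x) monoid_scheme \<Rightarrow> nat" where
  "comm_count_upto n A G = (\<Sum>k=1..n. comm_count k A G)"

(* The Riemann zeta function on its half-line of convergence s > 1. *)
definition riemann_zeta :: "real \<Rightarrow> real" where
  "riemann_zeta s = (\<Sum>n. 1 / real (Suc n) powr s)"

lemma heisenberg_group: "group (heisenberg :: ('a::comm_ring_1 ^ 3 ^ 3) monoid)"
proof (rule groupI)
  fix x :: "'a ^ 3 ^ 3" assume x: "x \<in> carrier heisenberg"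
  define y :: "'a ^ 3 ^ 3" where
    "y = vector [vector [1, - (x$1$2), x$1$2 * x$2$3 - x$1$3],
                 vector [0, 1, - (x$2$3)], vector [0, 0, 1]]"
  have "y \<in> carrier heisenberg"
    by (simp add: y_def heisenberg_def)
  moreover have "y ** x = mat 1"
    using x by (simp add: y_def heisenberg_def vec_eq_iff matrix_matrix_mult_def sum_3 forall_3 mat_def)
  ultimately show "\<exists>y\<in>carrier heisenberg. y \<otimes>\<^bsub>heisenberg\<^esub> x = \<one>\<^bsub>heisenberg\<^esub>"
    by (auto simp: heisenberg_def)
next
  show "\<one>\<^bsub>heisenberg\<^esub> \<in> carrier (heisenberg :: ('a ^ 3 ^ 3) monoid)"
    by (simp add: heisenberg_def mat_def)
next
  fix x y :: "'a ^ 3 ^ 3" assume "x \<in> carrier heisenberg" "y \<in> carrier heisenberg"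
  then show "x \<otimes>\<^bsub>heisenberg\<^esub> y \<in> carrier heisenberg"
    by (simp add: heisenberg_def matrix_matrix_mult_def sum_3)
qed (simp_all add: heisenberg_def matrix_mul_assoc)

lemma heisenberg_int_eq: "heisenberg_int = {M \<in> carrier heisenberg. \<forall>i j. M $ i $ j \<in> \<int>}"
proof (intro equalityI subsetI)
  fix M :: "real ^ 3 ^ 3" assume M: "M \<in> {M \<in> carrier heisenberg. \<forall>i j. M $ i $ j \<in> \<int>}"
  define N :: "int ^ 3 ^ 3" where "N = map_matrix floor M"
  have "N \<in> carrier heisenberg" using M by (auto simp: N_def heisenberg_def)
  moreover have "M = map_matrix of_int N" using M
    by (auto simp: N_def vec_eq_iff)
  ultimately show "M \<in> heisenberg_int" unfolding heisenberg_int_def by blast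
qed (auto simp: heisenberg_int_def heisenberg_def)

lemma heisenberg_int_subgroup: "subgroup heisenberg_int heisenberg"
proof -
  interpret group "heisenberg :: (real ^ 3 ^ 3) monoid" by (rule heisenberg_group)
  show ?thesis
  proof (rule subgroupI)
    fix x assume x: "x \<in> heisenberg_int"
    define y :: "real ^ 3 ^ 3" where
      "y = vector [vector [1, - (x$1$2), x$1$2 * x$2$3 - x$1$3],
                   vector [0, 1, - (x$2$3)], vector [0, 0, 1]]"
    have y: "y \<in> heisenberg_int"
      using x by (simp add: y_def heisenberg_int_eq heisenberg_def forall_3)
    have "y \<otimes>\<^bsub>heisenberg\<^esub> x = \<one>\<^bsub>heisenberg\<^esub>"
      using x by (simp add: y_def heisenberg_int_eq heisenberg_def vec_eq_iff
          matrix_matrix_mult_def sum_3 forall_3 mat_def)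
    then have "inv\<^bsub>heisenberg\<^esub> x = y"
      using x y by (intro inv_equality) (auto simp: heisenberg_int_eq)
    with y show "inv\<^bsub>heisenberg\<^esub> x \<in> heisenberg_int" by simp
  next
    have "\<one>\<^bsub>heisenberg\<^esub> \<in> heisenberg_int"
      by (auto simp: heisenberg_int_eq heisenberg_def mat_def)
    then show "heisenberg_int \<noteq> {}" by blast
  qed (auto simp: heisenberg_int_eq heisenberg_def matrix_matrix_mult_def sum_3)
qed

end

theory Submission
  imports Defs "HOL-Real_Asymp.Real_Asymp"
begin

text \<open>
  Let \<open>A = H(\<int>)\<close> and let \<open>g\<close> have the entries \<open>a\<close> and \<open>b\<close> above the diagonal. Conjugation by \<open>g\<close>
  changes an element with superdiagonal \<open>(x, y)\<close> only in the corner, by \<open>x b - a y\<close>. So both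
  indices of \<open>A \<inter> A\<^sup>g\<close> equal the order of the subgroup of \<open>\<real>/\<int>\<close> generated by \<open>a\<close> and \<open>b\<close>, and the
  normalizer of \<open>A\<close> consists of the matrices with integral superdiagonal. Hence \<open>c\<^sub>n\<close> is the number
  of elements of order \<open>n\<close> in \<open>(\<rat>/\<int>)\<^sup>2\<close>, i.e. Jordan's totient \<open>J(n)\<close> of degree 2.

  Let \<open>F(n)\<close> be the sum of \<open>J(k)\<close> over \<open>k \<le> n\<close>. Summing \<open>m\<^sup>2 = \<Sum>\<^sub>d J(d)\<close> (\<open>d\<close> dividing \<open>m\<close>) over
  \<open>m \<le> n\<close> gives \<open>\<Sum>\<^sub>d F(\<lfloor>n/d\<rfloor>) = n\<^sup>3/3 + O(n\<^sup>2)\<close>. Instead of inverting this with the Moebius function,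
  put \<open>x(n) = F(n)/n\<^sup>3 - L\<close> with \<open>L = 1/(3 \<zeta>(3))\<close>; then \<open>\<Sum>\<^sub>d x(\<lfloor>n/d\<rfloor>)/d\<^sup>3\<close> tends to 0, and since the
  terms with \<open>d \<ge> 2\<close> have total weight \<open>\<zeta>(3) - 1 < 1\<close>, the bounded sequence \<open>x\<close> tends to 0 as well.
\<close>

subsection \<open>Primitive pairs\<close>

text \<open>For n > 0 the condition says that i, j and n have no common factor, so that (i/n, j/n)
  has order exactly n in (\<rat>/\<int>)^2.\<close>

definition primitive_pairs :: "nat \<Rightarrow> (nat \<times> nat) set" where
  "primitive_pairs n = {(i, j). i < n \<and> j < n \<and> coprime i (gcd j n)}"

lemma finite_primitive_pairs: "finite (primitive_pairs n)"
  by (rule finite_subset[of _ "{..<n} \<times> {..<n}"]) (auto simp: primitive_pairs_def)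

lemma card_primitive_pairs_le: "card (primitive_pairs n) \<le> n ^ 2"
proof -
  have "card (primitive_pairs n) \<le> card ({..<n} \<times> {..<n})"
    by (rule card_mono) (auto simp: primitive_pairs_def)
  then show ?thesis by (simp add: power2_eq_square)
qed

text \<open>Sorting the m^2 pairs of fractions (x/m, y/m) by their least common denominator d, which
  divides m, leaves the primitive pairs for d.\<close>

lemma sum_card_primitive_pairs_divisors:
  assumes m: "m > 0"
  shows "(\<Sum>d | d dvd m. card (primitive_pairs d)) = m ^ 2"
proof -
  let ?S = "SIGMA d : {d. d dvd m}. primitive_pairs d"
  \<comment> \<open>\<open>?f\<close> expands a pair with denominator d to denominator m;
    \<open>?g\<close> cancels the common factor of x, y and m.\<close>
  let ?f = "\<lambda>(d, i, j). (i * (m div d), j * (m div d))"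
  let ?g = "\<lambda>(x, y). let g = gcd x (gcd y m) in (m div g, x div g, y div g)"
  have "bij_betw ?f ?S ({..<m} \<times> {..<m})"
  proof (rule bij_betw_byWitness[where f' = ?g])
    have A: "?g (?f (d, i, j)) = (d, i, j) \<and> ?f (d, i, j) \<in> {..<m} \<times> {..<m}"
      if "d dvd m" "(i, j) \<in> primitive_pairs d" for d i j
    proof -
      obtain e where e: "m = d * e" using \<open>d dvd m\<close> by blast
      then have pos: "d > 0" "e > 0" using m by auto
      have "gcd (i * e) (gcd (j * e) (d * e)) = gcd i (gcd j d) * e"
        by (simp add: gcd_mult_right) (simp add: ac_simps)
      also have "\<dots> = e" using that(2) by (simp add: primitive_pairs_def)
      finally show ?thesis using that(2) pos by (simp add: e primitive_pairs_def)
    qed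
    then show "\<forall>a\<in>?S. ?g (?f a) = a" "?f ` ?S \<subseteq> {..<m} \<times> {..<m}" by auto
    have B: "?f (?g (x, y)) = (x, y) \<and> ?g (x, y) \<in> ?S" if "x < m" "y < m" for x y
    proof -
      define g where "g = gcd x (gcd y m)"
      have "g > 0" using m by (simp add: g_def)
      have "g dvd x" "g dvd y" "g dvd m" unfolding g_def by (auto intro: dvd_trans[OF gcd_dvd2])
      then obtain x' y' m' where e: "x = g * x'" "y = g * y'" "m = g * m'" by (auto elim!: dvdE)
      have "g * gcd x' (gcd y' m') = gcd x (gcd y m)"
        unfolding e by (simp only: gcd_mult_distrib_nat)
      then have "g * gcd x' (gcd y' m') = g" by (simp only: g_def)
      with \<open>g > 0\<close> have "coprime x' (gcd y' m')" by (simp add: coprime_iff_gcd_eq_1)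
      moreover have "?g (x, y) = (m', x', y')"
        using \<open>g > 0\<close> unfolding prod.case Let_def g_def[symmetric] by (simp add: e)
      moreover have "m div m' = g" using m by (simp add: e)
      ultimately show ?thesis using that \<open>g > 0\<close> by (simp add: e primitive_pairs_def)
    qed
    then show "\<forall>b\<in>{..<m} \<times> {..<m}. ?f (?g b) = b" "?g ` ({..<m} \<times> {..<m}) \<subseteq> ?S" by blast+
  qed
  then have "card ?S = m ^ 2" by (simp add: bij_betw_same_card power2_eq_square)
  moreover have "card ?S = (\<Sum>d | d dvd m. card (primitive_pairs d))"
    using m by (intro card_SigmaI) (auto simp: finite_primitive_pairs)
  ultimately show ?thesis by simp
qed

text \<open>Put m = d e: the pairs with d e \<le> n are sorted by d on the left and by their product
  m on the right.\<close>

lemma sum_sum_div_eq_sum_sum_dvd: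
  fixes h :: "nat \<Rightarrow> 'a::comm_monoid_add"
  shows "(\<Sum>d=1..n. \<Sum>e=1..n div d. h e) = (\<Sum>m=1..n. \<Sum>e | e dvd m. h e)"
proof -
  have le: "k \<le> n" if "b * k \<le> n" "b > 0" for b k
    using that by (metis Suc_leI One_nat_def le_trans mult_1 mult_le_mono1)
  have "(\<Sum>d=1..n. \<Sum>e=1..n div d. h e) = (\<Sum>(d, e)\<in>(SIGMA d:{1..n}. {1..n div d}). h e)"
    by (simp add: sum.Sigma)
  also have "\<dots> = (\<Sum>(m, e)\<in>(SIGMA m:{1..n}. {e. e dvd m}). h e)"
    by (rule sum.reindex_bij_witness[where i = "\<lambda>(m, e). (m div e, e)" and j = "\<lambda>(d, e). (d * e, e)"])
      (auto simp: less_eq_div_iff_mult_less_eq Suc_le_eq mult.commute elim!: dvdE intro: le)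
  also have "\<dots> = (\<Sum>m=1..n. \<Sum>e | e dvd m. h e)"
    by (subst sum.Sigma) auto
  finally show ?thesis .
qed

subsection \<open>Weighted sums over quotients\<close>

lemma filterlim_div_nat_at_top:
  assumes "(c::nat) > 0"
  shows "filterlim (\<lambda>n. n div c) at_top at_top"
  unfolding filterlim_at_top
proof
  fix Z
  show "eventually (\<lambda>n. Z \<le> n div c) at_top"
    using eventually_ge_at_top[of "Z * c"]
    by eventually_elim (use assms in \<open>simp add: less_eq_div_iff_mult_less_eq\<close>)
qed

text \<open>Extending each finite sum by zeros to a series makes this Tannery's theorem, with the
  summable majorant \<open>w k * B\<close>.\<close>

lemma weighted_sum_tendsto_0:
  fixes w :: "nat \<Rightarrow> real" and y :: "nat \<Rightarrow> nat \<Rightarrow> real"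
  assumes w: "summable w" "\<And>k. w k \<ge> 0"
    and bound: "\<And>n k. \<bar>y n k\<bar> \<le> B"
    and lim: "\<And>k. (\<lambda>n. y n k) \<longlonglongrightarrow> 0"
  shows "(\<lambda>n. \<Sum>k<n. w k * y n k) \<longlonglongrightarrow> 0"
proof -
  define a where "a k n = (if k < n then w k * y n k else 0)" for k n
  have B: "B \<ge> 0" using bound[of 0 0] by linarith
  have "(\<lambda>n. suminf (\<lambda>k. a k n)) \<longlonglongrightarrow> (\<Sum>k::nat. 0 :: real)"
  proof (rule tannerys_theorem[THEN conjunct2, THEN conjunct2])
    fix k
    have "(\<lambda>n. w k * y n k) \<longlonglongrightarrow> w k * 0" by (intro tendsto_intros lim)
    moreover have "eventually (\<lambda>n. w k * y n k = a k n) sequentially"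
      using eventually_gt_at_top[of k] by eventually_elim (simp add: a_def)
    ultimately show "a k \<longlonglongrightarrow> 0" by (simp cong: tendsto_cong) (use filterlim_cong in force)
  next
    have "norm (a k n) \<le> w k * B" for k n
      using bound[of n k] w(2)[of k] B by (simp add: a_def abs_mult mult_left_mono)
    then show "eventually (\<lambda>(k, n). norm (a k n) \<le> w k * B) (at_top \<times>\<^sub>F sequentially)"
      by (intro always_eventually) auto
    show "summable (\<lambda>k. w k * B)" using w(1) by (rule summable_mult2)
  qed simp
  moreover have "suminf (\<lambda>k. a k n) = (\<Sum>k<n. w k * y n k)" for n
    by (subst suminf_finite[of "{..<n}"]) (auto simp: a_def)
  ultimately show ?thesis by simp
qed

text \<open>For fixed k the quotient \<open>n div Suc k\<close> tends to infinity, so every single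
  term tends to 0, and boundedness of x supplies the majorant.\<close>

lemma weighted_div_sum_tendsto_0:
  fixes w x :: "nat \<Rightarrow> real"
  assumes w: "summable w" "\<And>k. w k \<ge> 0" and x: "Bseq x" "x \<longlonglongrightarrow> 0"
  shows "(\<lambda>n. \<Sum>k<n. w k * x (n div Suc k)) \<longlonglongrightarrow> 0"
proof -
  obtain B where "\<And>n. \<bar>x n\<bar> \<le> B" using x(1) unfolding Bseq_def real_norm_def by blast
  then show ?thesis
    using w by (rule_tac weighted_sum_tendsto_0)
      (auto intro!: filterlim_compose[OF x(2)] filterlim_div_nat_at_top)
qed

text \<open>The term k = 0 is \<open>x n\<close> itself, and the remaining weights add up to q < 1.
  Hence the limit superior s of |x| is finite and satisfies s \<le> q s, which forces s = 0.\<close>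

lemma tendsto_0_if_weighted_div_sum_tendsto_0:
  fixes w x :: "nat \<Rightarrow> real"
  assumes w: "summable w" "\<And>k. w k \<ge> 0" "w 0 = 1" "(\<Sum>k. w (Suc k)) < 1"
    and x: "Bseq x" and lim: "(\<lambda>n. \<Sum>k<n. w k * x (n div Suc k)) \<longlonglongrightarrow> 0"
  shows "x \<longlonglongrightarrow> 0"
proof -
  define q where "q = (\<Sum>k. w (Suc k))"
  \<comment> \<open>Any r strictly between q and 1 would serve: the gap r - q leaves room for the
    null sequences, and r < 1 makes the bounds shrink geometrically.\<close>
  define r where "r = (1 + q) / 2"
  define v where "v = w(0 := 0)"
  have v0: "v k \<ge> 0" for k using w by (simp add: v_def)
  have "(\<lambda>k. v (Suc k)) sums q"
    using w(1) by (simp add: v_def q_def summable_sums summable_Suc_iff)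
  then have "v sums (q + v 0)" by (simp only: sums_Suc_iff)
  then have v_sums: "v sums q" by (simp add: v_def)
  then have v: "summable v" "suminf v = q" by (simp_all add: sums_iff)
  have q: "0 \<le> q" "q < 1" using suminf_nonneg[OF v(1) v0] v(2) w(4) by (simp_all add: q_def)
  have r: "0 < r" "r < 1" "q < r" using q by (simp_all add: r_def)
  obtain B where B: "B > 0" "\<And>n. \<bar>x n\<bar> \<le> B" using x unfolding Bseq_def real_norm_def by blast
  \<comment> \<open>An eventual bound \<open>M\<close> on \<open>\<bar>x\<bar>\<close> improves to \<open>r M\<close>: up to a null sequence, \<open>\<bar>x n\<bar>\<close> is at most \<open>q M\<close>.\<close>
  have step: "eventually (\<lambda>n. \<bar>x n\<bar> \<le> r * M) sequentially"
    if M: "M > 0" and ev: "eventually (\<lambda>n. \<bar>x n\<bar> \<le> M) sequentially" for M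
  proof -
    \<comment> \<open>The bound M holds only eventually, whereas \<open>n div Suc k\<close> is small
      for large k. The excess z over M is nonzero only finitely often, so its weighted sum is
      null.\<close>
    define z where "z n = max 0 (\<bar>x n\<bar> - M)" for n
    have "eventually (\<lambda>n. z n = 0) sequentially"
      using ev by eventually_elim (simp add: z_def)
    then have "z \<longlonglongrightarrow> 0" by (rule tendsto_eventually)
    moreover have "norm (z n) \<le> B" for n using B(1) B(2)[of n] M by (simp add: z_def)
    then have "Bseq z" by (rule BseqI')
    ultimately have "(\<lambda>n. (\<Sum>k<n. v k * z (n div Suc k)) + \<bar>\<Sum>k<n. w k * x (n div Suc k)\<bar>) \<longlonglongrightarrow> 0 + \<bar>0\<bar>"
      by (intro tendsto_intros weighted_div_sum_tendsto_0 v v0 lim)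
    moreover have "(r - q) * M > 0" using r M by simp
    ultimately have "eventually (\<lambda>n. (\<Sum>k<n. v k * z (n div Suc k)) +
        \<bar>\<Sum>k<n. w k * x (n div Suc k)\<bar> < (r - q) * M) sequentially"
      by (intro order_tendstoD) auto
    with eventually_gt_at_top[of 0] show ?thesis
    proof eventually_elim
      case (elim n)
      have "(\<Sum>k<n. w k * x (n div Suc k)) = x n + (\<Sum>k<n. v k * x (n div Suc k))"
        using elim(1) w(3) by (cases n) (simp_all add: sum.lessThan_Suc_shift v_def del: sum.lessThan_Suc)
      moreover have "\<bar>\<Sum>k<n. v k * x (n div Suc k)\<bar> \<le> (\<Sum>k<n. v k * (M + z (n div Suc k)))"
        by (rule order_trans[OF sum_abs], rule sum_mono)
          (auto simp: abs_mult z_def v0 intro!: mult_left_mono)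
      moreover have "(\<Sum>k<n. v k * (M + z (n div Suc k))) = (\<Sum>k<n. v k) * M + (\<Sum>k<n. v k * z (n div Suc k))"
        by (simp add: distrib_left sum.distrib sum_distrib_right)
      moreover have "(\<Sum>k<n. v k) * M \<le> q * M"
        using sum_le_suminf[OF v(1), of "{..<n}"] v0 v(2) M by (intro mult_right_mono) auto
      ultimately show "\<bar>x n\<bar> \<le> r * M" using elim(2) by (simp add: left_diff_distrib)
    qed
  qed
  have iter: "eventually (\<lambda>n. \<bar>x n\<bar> \<le> r ^ j * B) sequentially" for j
  proof (induction j)
    case (Suc j)
    then show ?case using step[of "r ^ j * B"] B r by (simp add: mult.assoc)
  qed (use B in simp)
  show ?thesis
  proof (rule tendstoI)
    fix e :: real assume "e > 0"
    then obtain j where "r ^ j < e / B" using real_arch_pow_inv[of "e / B" r] B r by auto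
    then have "r ^ j * B < e" using B by (simp add: field_simps)
    with iter[of j] show "eventually (\<lambda>n. dist (x n) 0 < e) sequentially"
      by (auto elim!: eventually_mono)
  qed
qed

section \<open>Cubic growth from sums over quotients\<close>

lemma div_mult_divide_tendsto_1:
  assumes "(c::nat) > 0"
  shows "(\<lambda>n. real (n div c * c) / real n) \<longlonglongrightarrow> 1"
proof (rule tendsto_sandwich)
  show "eventually (\<lambda>n. 1 - real c / real n \<le> real (n div c * c) / real n) sequentially"
    using eventually_gt_at_top[of 0]
  proof eventually_elim
    case (elim n)
    have "n \<le> n div c * c + c"
      using div_mult_mod_eq[of n c] mod_less_divisor[OF assms, of n] by linarith
    then have "real n \<le> real (n div c * c) + real c" by (simp only: of_nat_add[symmetric] of_nat_le_iff)
    then have "(real n - real c) / real n \<le> real (n div c * c) / real n"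
      by (intro divide_right_mono) simp_all
    with elim show ?case by (simp add: diff_divide_distrib)
  qed
  show "eventually (\<lambda>n. real (n div c * c) / real n \<le> 1) sequentially"
    using eventually_gt_at_top[of 0]
  proof eventually_elim
    case (elim n)
    have "real (n div c * c) \<le> real n" by (simp only: of_nat_le_iff div_times_less_eq_dividend)
    with elim show ?case by simp
  qed
  show "(\<lambda>n. 1 - real c / real n) \<longlonglongrightarrow> 1" by real_asymp
qed simp

text \<open>From 2(k+1) \<le> (k+2)^2, each term 1/(k+2)^3 is at most half of 1/(k+1) - 1/(k+2), and
  these halves add up to 1/2. The second claim, \<zeta>(3) - 1 < 1, is what makes the contraction
  argument work.\<close>

lemma summable_inverse_cubes:
  "summable (\<lambda>k. 1 / real (Suc k) ^ 3)" "(\<Sum>k. 1 / real (Suc (Suc k)) ^ 3) < 1"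
proof -
  have s: "(\<lambda>k. 1 / real (Suc k) - 1 / real (Suc (Suc k))) sums (1 / real (Suc 0) - 0)"
    by (rule telescope_sums') real_asymp
  then have s: "(\<lambda>k. (1 / real (Suc k) - 1 / real (Suc (Suc k))) / 2) sums (1 / 2)"
    using sums_divide by fastforce
  have le: "1 / real (Suc (Suc k)) ^ 3 \<le> (1 / real (Suc k) - 1 / real (Suc (Suc k))) / 2" for k
  proof -
    have "2 * (real k + 1) * (real k + 2) \<le> (real k + 2) ^ 2 * (real k + 2)"
      by (intro mult_right_mono) (simp_all add: power2_eq_square algebra_simps)
    also have "\<dots> = real (Suc (Suc k)) ^ 3" by (simp add: power2_eq_square power3_eq_cube add.commute)
    finally have "1 / real (Suc (Suc k)) ^ 3 \<le> 1 / (2 * (real k + 1) * (real k + 2))"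
      by (intro frac_le) auto
    also have "\<dots> = (1 / real (Suc k) - 1 / real (Suc (Suc k))) / 2"
      by (simp add: field_simps)
    finally show ?thesis .
  qed
  have summ: "summable (\<lambda>k. 1 / real (Suc (Suc k)) ^ 3)"
    by (rule summable_comparison_test'[OF sums_summable[OF s]]) (use le in simp)
  then show "summable (\<lambda>k. 1 / real (Suc k) ^ 3)"
    by (subst summable_Suc_iff[symmetric])
  show "(\<Sum>k. 1 / real (Suc (Suc k)) ^ 3) < 1"
    using suminf_le[OF le summ sums_summable[OF s]] sums_unique[OF s] by simp
qed

text \<open>With d = Suc k and f(n) = F(n)/n^3, the term F(n div d)/n^3 is f(n div d)/d^3 times the
  cube of d (n div d)/n, a ratio that tends to 1. Dropping this factor and subtracting the expected
  limit L leaves a null weighted sum of f - L, to which the contraction applies.\<close>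

lemma cubic_growth_from_div_sum:
  fixes F :: "nat \<Rightarrow> real"
  assumes bound: "\<And>n. \<bar>F n\<bar> \<le> C * real n ^ 3"
    and lim: "(\<lambda>n. (\<Sum>k<n. F (n div Suc k)) / real n ^ 3) \<longlonglongrightarrow> s"
  shows "(\<lambda>n. F n / real n ^ 3) \<longlonglongrightarrow> s / (\<Sum>k. 1 / real (Suc k) ^ 3)"
proof -
  define w where "w k = 1 / real (Suc k) ^ 3" for k
  define L where "L = s / suminf w"
  define f where "f n = F n / real n ^ 3" for n
  have w: "summable w" "\<And>k. w k \<ge> 0" "w 0 = 1" "(\<Sum>k. w (Suc k)) < 1"
    using summable_inverse_cubes by (simp_all add: w_def[abs_def])
  have "suminf w > 0" by (rule suminf_pos[OF w(1)]) (simp add: w_def)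
  then have L: "suminf w * L = s" by (simp add: L_def)
  have C: "C \<ge> 0" using bound[of 1] by simp
  have f_bound: "\<bar>f n\<bar> \<le> C" for n
    using bound[of n] C by (cases "n = 0") (simp_all add: f_def field_simps)
  \<comment> \<open>\<open>w k * y n k\<close> is the correction that turns F(n div d)/n^3, with d =
    Suc k, into f(n div d)/d^3.\<close>
  define y where "y n k = f (n div Suc k) * (1 - (real (n div Suc k * Suc k) / real n) ^ 3)" for n k
  have "(\<lambda>n. \<Sum>k<n. w k * y n k) \<longlonglongrightarrow> 0"
  proof (rule weighted_sum_tendsto_0[OF w(1,2)])
    fix n k
    have "real (n div Suc k * Suc k) / real n \<le> 1"
      using div_times_less_eq_dividend[of n "Suc k"]
      by (cases "n = 0") (simp_all only: of_nat_le_iff divide_le_eq_1 of_nat_0_less_iff, auto)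
    then have "(real (n div Suc k * Suc k) / real n) ^ 3 \<le> 1" by (intro power_le_one) auto
    then have "\<bar>1 - (real (n div Suc k * Suc k) / real n) ^ 3\<bar> \<le> 1" by simp
    then show "\<bar>y n k\<bar> \<le> C" unfolding y_def abs_mult
      using f_bound C by (metis mult_mono abs_ge_zero mult.right_neutral)
  next
    fix k
    have "(\<lambda>n. 1 - (real (n div Suc k * Suc k) / real n) ^ 3) \<longlonglongrightarrow> 1 - 1 ^ 3"
      by (intro tendsto_intros div_mult_divide_tendsto_1) simp
    then have "(\<lambda>n. 1 - (real (n div Suc k * Suc k) / real n) ^ 3) \<longlonglongrightarrow> 0" by simp
    then have "(\<lambda>n. C * \<bar>1 - (real (n div Suc k * Suc k) / real n) ^ 3\<bar>) \<longlonglongrightarrow> 0"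
      by (intro tendsto_mult_right_zero tendsto_rabs_zero)
    moreover have "norm (y n k) \<le> C * \<bar>1 - (real (n div Suc k * Suc k) / real n) ^ 3\<bar>" for n
      unfolding y_def real_norm_def abs_mult by (intro mult_right_mono f_bound) simp
    ultimately show "(\<lambda>n. y n k) \<longlonglongrightarrow> 0"
      by (intro Lim_null_comparison[of "\<lambda>n. y n k", OF always_eventually]) auto
  qed
  moreover have "(\<lambda>n. (\<Sum>k<n. w k) * L) \<longlonglongrightarrow> suminf w * L"
    by (intro tendsto_intros summable_LIMSEQ w)
  ultimately have "(\<lambda>n. (\<Sum>k<n. w k * y n k) + (\<Sum>k<n. F (n div Suc k)) / real n ^ 3 - (\<Sum>k<n. w k) * L)
      \<longlonglongrightarrow> 0 + s - suminf w * L"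
    by (intro tendsto_diff tendsto_add lim)
  moreover have "(\<Sum>k<n. w k * y n k) + (\<Sum>k<n. F (n div Suc k)) / real n ^ 3 - (\<Sum>k<n. w k) * L =
      (\<Sum>k<n. w k * (f (n div Suc k) - L))" for n
  proof -
    have "w k * y n k + F (n div Suc k) / real n ^ 3 - w k * L = w k * (f (n div Suc k) - L)"
      if "k < n" for k
    proof -
      define m where "m = real (n div Suc k)"
      \<comment> \<open>As k < n, the quotient is positive, so dividing by m^3 and multiplying back
        recovers F.\<close>
      have "m > 0" using that by (simp add: m_def div_greater_zero_iff)
      then have F: "F (n div Suc k) = f (n div Suc k) * m ^ 3" by (simp add: f_def m_def)
      define t where "t = (real (n div Suc k * Suc k) / real n) ^ 3"
      have "w k * t = m ^ 3 / real n ^ 3"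
        unfolding t_def of_nat_mult m_def[symmetric] by (simp add: w_def power_divide power_mult_distrib)
      then have "F (n div Suc k) / real n ^ 3 = f (n div Suc k) * (w k * t)" by (simp add: F)
      moreover have "y n k = f (n div Suc k) * (1 - t)" unfolding y_def t_def ..
      ultimately show ?thesis by (simp only:) (simp add: algebra_simps)
    qed
    then have "(\<Sum>k<n. w k * y n k + F (n div Suc k) / real n ^ 3 - w k * L) =
        (\<Sum>k<n. w k * (f (n div Suc k) - L))"
      by (intro sum.cong) simp_all
    then show ?thesis
      by (simp only: sum_subtractf sum.distrib sum_divide_distrib sum_distrib_right)
  qed
  ultimately have "(\<lambda>n. \<Sum>k<n. w k * (f (n div Suc k) - L)) \<longlonglongrightarrow> 0" using L by simp
  moreover have "\<bar>f n - L\<bar> \<le> C + \<bar>L\<bar>" for n using f_bound[of n] by linarith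
  then have "Bseq (\<lambda>n. f n - L)" by (intro BseqI'[of _ "C + \<bar>L\<bar>"]) simp
  ultimately have "(\<lambda>n. f n - L) \<longlonglongrightarrow> 0"
    by (rule tendsto_0_if_weighted_div_sum_tendsto_0[OF w, rotated])
  then show ?thesis by (simp add: LIM_zero_iff f_def L_def w_def[abs_def])
qed

text \<open>The bound J(k) \<le> k^2 gives the cubic majorant, and the divisor identity turns the
  sum over quotients into 1^2 + ... + n^2, whose leading term is n^3/3.\<close>

lemma primitive_pairs_asymptotics:
  "(\<lambda>n. real (\<Sum>k=1..n. card (primitive_pairs k)) / real n ^ 3)
     \<longlonglongrightarrow> 1 / 3 / (\<Sum>k. 1 / real (Suc k) ^ 3)"
proof (rule cubic_growth_from_div_sum)
  fix n
  have "(\<Sum>k=1..n. card (primitive_pairs k)) \<le> (\<Sum>k=1..n. n ^ 2)"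
    by (intro sum_mono order_trans[OF card_primitive_pairs_le] power_mono) auto
  also have "\<dots> = n ^ 3" by (simp add: power2_eq_square power3_eq_cube)
  finally show "\<bar>real (\<Sum>k=1..n. card (primitive_pairs k))\<bar> \<le> 1 * real n ^ 3"
    by (metis abs_of_nat mult_1 of_nat_mono of_nat_power)
next
  have "(\<Sum>k<n. real (\<Sum>e=1..n div Suc k. card (primitive_pairs e))) = real n * (real n + 1) * (2 * real n + 1) / 6" for n
  proof -
    have "(\<Sum>k<n. \<Sum>e=1..n div Suc k. card (primitive_pairs e)) =
        (\<Sum>d=1..n. \<Sum>e=1..n div d. card (primitive_pairs e))"
      by (simp add: sum.atLeast1_atMost_eq)
    also have "\<dots> = (\<Sum>m=1..n. m ^ 2)"
      unfolding sum_sum_div_eq_sum_sum_dvd by (simp add: sum_card_primitive_pairs_divisors)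
    finally have "(\<Sum>k<n. real (\<Sum>e=1..n div Suc k. card (primitive_pairs e))) = real (\<Sum>m=1..n. m ^ 2)"
      by (metis of_nat_sum)
    also have "real (\<Sum>m=1..n. m ^ 2) = real n * (real n + 1) * (2 * real n + 1) / 6"
      by (induction n) (simp_all add: field_simps power2_eq_square)
    finally show ?thesis .
  qed
  moreover have "(\<lambda>n. real n * (real n + 1) * (2 * real n + 1) / 6 / real n ^ 3) \<longlonglongrightarrow> 1 / 3"
    by real_asymp
  ultimately show "(\<lambda>n. (\<Sum>k<n. real (\<Sum>e=1..n div Suc k. card (primitive_pairs e))) / real n ^ 3) \<longlonglongrightarrow> 1 / 3"
    by (simp only:)
qed

subsection \<open>Cosets, conjugates and normalizers\<close>

text \<open>Both images are the quotient of S by the same equivalence relation. So an index can be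
  read off from any function with the right fibres, without forming a quotient group.\<close>

lemma bij_betw_images:
  assumes "\<And>x y. x \<in> S \<Longrightarrow> y \<in> S \<Longrightarrow> f x = f y \<longleftrightarrow> g x = g y"
  shows "\<exists>h. bij_betw h (f ` S) (g ` S)"
proof -
  have "bij_betw (\<lambda>z. g (inv_into S f z)) (f ` S) (g ` S)"
  proof (rule bij_betwI')
    fix u v assume "u \<in> f ` S" "v \<in> f ` S"
    then show "(g (inv_into S f u) = g (inv_into S f v)) = (u = v)"
      using assms by (metis f_inv_into_f inv_into_into)
  next
    fix u assume "u \<in> f ` S"
    then show "g (inv_into S f u) \<in> g ` S" by (simp add: inv_into_into)
  next
    fix v assume "v \<in> g ` S"
    then obtain x where "x \<in> S" "v = g x" by blast
    then show "\<exists>u\<in>f ` S. v = g (inv_into S f u)"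
      using assms by (metis f_inv_into_f imageI inv_into_into)
  qed
  then show ?thesis by blast
qed

text \<open>The condition \<open>x \<otimes> inv y \<in> B\<close> characterizes equal right cosets,
  so f and the coset map have the same fibres.\<close>

lemma (in group) rcosets_bij_image:
  assumes B: "subgroup B G"
    and f: "\<And>x y. x \<in> carrier G \<Longrightarrow> y \<in> carrier G \<Longrightarrow> f x = f y \<longleftrightarrow> x \<otimes> inv y \<in> B"
  shows "\<exists>h. bij_betw h (rcosets B) (f ` carrier G)"
proof -
  have "B #> x = B #> y \<longleftrightarrow> f x = f y" if "x \<in> carrier G" "y \<in> carrier G" for x y
  proof -
    have "B #> x = B #> y \<longleftrightarrow> x \<in> B #> y"
      using that B by (metis rcos_self repr_independence)
    also have "\<dots> \<longleftrightarrow> x \<otimes> inv y \<in> B"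
      using subgroup.rcos_module[OF B is_group] that by blast
    finally show ?thesis using f that by simp
  qed
  moreover have "rcosets B = (\<lambda>x. B #> x) ` carrier G"
    by (auto simp: RCOSETS_def)
  ultimately show ?thesis
    using bij_betw_images[of "carrier G" "\<lambda>x. B #> x" f] by simp
qed

text \<open>Indices are defined with the carrier cut down to A, where inverses agree with those of
  G.\<close>

lemma (in group) subgroup_rcosets_bij_image:
  assumes A: "subgroup A G" and B: "subgroup B G" "B \<subseteq> A"
    and f: "\<And>x y. x \<in> A \<Longrightarrow> y \<in> A \<Longrightarrow> f x = f y \<longleftrightarrow> x \<otimes> inv y \<in> B"
  shows "\<exists>h. bij_betw h (rcosets\<^bsub>G\<lparr>carrier := A\<rparr>\<^esub> B) (f ` A)"
proof -
  have "group (G\<lparr>carrier := A\<rparr>)" by (rule subgroup_imp_group[OF A])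
  moreover have "subgroup B (G\<lparr>carrier := A\<rparr>)" using A B by (simp add: subgroup_incl)
  ultimately show ?thesis
    using group.rcosets_bij_image[of "G\<lparr>carrier := A\<rparr>" B f] f m_inv_consistent[OF A] by simp
qed

lemma (in group) inv_mult_cancel_left:
  assumes "x \<in> carrier G" "y \<in> carrier G"
  shows "inv x \<otimes> (x \<otimes> y) = y" "x \<otimes> (inv x \<otimes> y) = y"
  using assms by (simp_all flip: m_assoc)

lemma (in group) mem_conj_set_iff:
  assumes A: "A \<subseteq> carrier G" and g: "g \<in> carrier G"
  shows "x \<in> conj_set G A g \<longleftrightarrow> x \<in> carrier G \<and> g \<otimes> x \<otimes> inv g \<in> A"
proof
  assume "x \<in> conj_set G A g"
  then obtain a where a: "a \<in> A" "x = inv g \<otimes> a \<otimes> g"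
    by (auto simp: conj_set_def l_coset_def r_coset_def)
  moreover have "a \<in> carrier G" using a A by blast
  ultimately show "x \<in> carrier G \<and> g \<otimes> x \<otimes> inv g \<in> A"
    using g by (simp add: m_assoc inv_mult_cancel_left)
next
  assume x: "x \<in> carrier G \<and> g \<otimes> x \<otimes> inv g \<in> A"
  have "x = inv g \<otimes> (g \<otimes> x \<otimes> inv g) \<otimes> g"
    using x g by (simp add: m_assoc inv_mult_cancel_left)
  with x show "x \<in> conj_set G A g"
    unfolding conj_set_def l_coset_def r_coset_def by blast
qed

lemma (in group) subgroup_conj_set:
  assumes A: "subgroup A G" and g: "g \<in> carrier G"
  shows "subgroup (conj_set G A g) G"
proof (rule subgroupI)
  note mem = mem_conj_set_iff[OF subgroup.subset[OF A] g]
  show "conj_set G A g \<subseteq> carrier G" using mem by blast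
  have "\<one> \<in> conj_set G A g" unfolding mem using g subgroup.one_closed[OF A] by simp
  then show "conj_set G A g \<noteq> {}" by blast
  fix x assume x: "x \<in> conj_set G A g"
  then have "inv (g \<otimes> x \<otimes> inv g) \<in> A" using mem subgroup.m_inv_closed[OF A] by blast
  then show "inv x \<in> conj_set G A g"
    using x g unfolding mem by (simp add: inv_mult_group m_assoc)
  fix y assume y: "y \<in> conj_set G A g"
  have "(g \<otimes> x \<otimes> inv g) \<otimes> (g \<otimes> y \<otimes> inv g) \<in> A"
    using x y mem subgroup.m_closed[OF A] by blast
  moreover have "(g \<otimes> x \<otimes> inv g) \<otimes> (g \<otimes> y \<otimes> inv g) = g \<otimes> (x \<otimes> y) \<otimes> inv g"
    using x y g mem by (simp add: m_assoc inv_mult_cancel_left)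
  ultimately show "x \<otimes> y \<in> conj_set G A g" using x y mem by simp
qed

text \<open>\<open>normalizer\<close> acts by g A g^-1, whereas \<open>conj_set\<close> is g^-1 A g;
  hence the inverse.\<close>

lemma (in group) mem_normalizer_iff:
  assumes "A \<subseteq> carrier G"
  shows "g \<in> normalizer G A \<longleftrightarrow> g \<in> carrier G \<and> conj_set G A (inv g) = A"
  using assms by (auto simp: normalizer_def stabilizer_def conj_set_def)

subsection \<open>Commensurability in the Heisenberg group\<close>

abbreviation heis :: "(real ^ 3 ^ 3) monoid" where "heis \<equiv> heisenberg"

interpretation heis: group heis by (rule heisenberg_group)

lemma heis_mult_entries:
  assumes "x \<in> carrier heis" "y \<in> carrier heis"
  shows "(x \<otimes>\<^bsub>heis\<^esub> y) $ 1 $ 2 = x $ 1 $ 2 + y $ 1 $ 2"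
    and "(x \<otimes>\<^bsub>heis\<^esub> y) $ 2 $ 3 = x $ 2 $ 3 + y $ 2 $ 3"
    and "(x \<otimes>\<^bsub>heis\<^esub> y) $ 1 $ 3 = x $ 1 $ 3 + y $ 1 $ 3 + x $ 1 $ 2 * y $ 2 $ 3"
  using assms by (auto simp: heisenberg_def matrix_matrix_mult_def sum_3)

lemma heis_inv_entries:
  assumes "x \<in> carrier heis"
  shows "(inv\<^bsub>heis\<^esub> x) $ 1 $ 2 = - x $ 1 $ 2"
    and "(inv\<^bsub>heis\<^esub> x) $ 2 $ 3 = - x $ 2 $ 3"
    and "(inv\<^bsub>heis\<^esub> x) $ 1 $ 3 = x $ 1 $ 2 * x $ 2 $ 3 - x $ 1 $ 3"
proof -
  have i: "inv\<^bsub>heis\<^esub> x \<in> carrier heis" using assms by simp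
  have "x \<otimes>\<^bsub>heis\<^esub> inv\<^bsub>heis\<^esub> x = mat 1"
    using assms heis.r_inv by (simp add: heisenberg_def)
  then have e: "(x \<otimes>\<^bsub>heis\<^esub> inv\<^bsub>heis\<^esub> x) $ 1 $ 2 = 0" "(x \<otimes>\<^bsub>heis\<^esub> inv\<^bsub>heis\<^esub> x) $ 2 $ 3 = 0"
    "(x \<otimes>\<^bsub>heis\<^esub> inv\<^bsub>heis\<^esub> x) $ 1 $ 3 = 0"
    by (simp_all add: mat_def)
  note e = e[unfolded heis_mult_entries[OF assms i]]
  show 12: "(inv\<^bsub>heis\<^esub> x) $ 1 $ 2 = - x $ 1 $ 2" using e(1) by simp
  show 23: "(inv\<^bsub>heis\<^esub> x) $ 2 $ 3 = - x $ 2 $ 3" using e(2) by simp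
  show "(inv\<^bsub>heis\<^esub> x) $ 1 $ 3 = x $ 1 $ 2 * x $ 2 $ 3 - x $ 1 $ 3"
    using e(3) 23 by simp
qed

text \<open>The shift of the corner is the corner of the commutator of g and x, an alternating form
  in the two superdiagonals.\<close>

lemma heis_conj_entries:
  assumes "g \<in> carrier heis" "x \<in> carrier heis"
  shows "(g \<otimes>\<^bsub>heis\<^esub> x \<otimes>\<^bsub>heis\<^esub> inv\<^bsub>heis\<^esub> g) $ 1 $ 2 = x $ 1 $ 2"
    and "(g \<otimes>\<^bsub>heis\<^esub> x \<otimes>\<^bsub>heis\<^esub> inv\<^bsub>heis\<^esub> g) $ 2 $ 3 = x $ 2 $ 3"
    and "(g \<otimes>\<^bsub>heis\<^esub> x \<otimes>\<^bsub>heis\<^esub> inv\<^bsub>heis\<^esub> g) $ 1 $ 3 =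
           x $ 1 $ 3 - (x $ 1 $ 2 * g $ 2 $ 3 - g $ 1 $ 2 * x $ 2 $ 3)"
  using assms by (auto simp: heis_mult_entries heis_inv_entries algebra_simps)

definition heis_mat :: "real \<Rightarrow> real \<Rightarrow> real \<Rightarrow> real ^ 3 ^ 3" where
  "heis_mat a b c = vector [vector [1, a, c], vector [0, 1, b], vector [0, 0, 1]]"

lemma heis_mat_carrier [simp]: "heis_mat a b c \<in> carrier heis"
  by (simp add: heis_mat_def heisenberg_def)

lemma heis_mat_entries [simp]:
  "heis_mat a b c $ 1 $ 2 = a" "heis_mat a b c $ 2 $ 3 = b" "heis_mat a b c $ 1 $ 3 = c"
  by (simp_all add: heis_mat_def)

lemma mem_heisenberg_int_iff:
  "x \<in> heisenberg_int \<longleftrightarrow> x \<in> carrier heis \<and> x $ 1 $ 2 \<in> \<int> \<and> x $ 2 $ 3 \<in> \<int> \<and> x $ 1 $ 3 \<in> \<int>"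
  by (auto simp: heisenberg_int_eq heisenberg_def forall_3)

lemma mem_conj_heisenberg_int_iff:
  assumes "g \<in> carrier heis"
  shows "x \<in> conj_set heis heisenberg_int g \<longleftrightarrow> x \<in> carrier heis \<and> x $ 1 $ 2 \<in> \<int> \<and> x $ 2 $ 3 \<in> \<int> \<and>
           x $ 1 $ 3 - (x $ 1 $ 2 * g $ 2 $ 3 - g $ 1 $ 2 * x $ 2 $ 3) \<in> \<int>"
  using assms by (auto simp: heis.mem_conj_set_iff[OF subgroup.subset[OF heisenberg_int_subgroup]]
      mem_heisenberg_int_iff heis_conj_entries)

lemma mem_normalizer_heisenberg_int_iff:
  "g \<in> normalizer heis heisenberg_int \<longleftrightarrow> g \<in> carrier heis \<and> g $ 1 $ 2 \<in> \<int> \<and> g $ 2 $ 3 \<in> \<int>"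
proof -
  have "conj_set heis heisenberg_int (inv\<^bsub>heis\<^esub> g) = heisenberg_int \<longleftrightarrow> g $ 1 $ 2 \<in> \<int> \<and> g $ 2 $ 3 \<in> \<int>"
    if g: "g \<in> carrier heis"
  proof
    note mem = mem_conj_heisenberg_int_iff[OF heis.inv_closed[OF g]]
    assume eq: "conj_set heis heisenberg_int (inv\<^bsub>heis\<^esub> g) = heisenberg_int"
    \<comment> \<open>Conjugation shifts the corners of these two elementary matrices by the
      superdiagonal entries of g, up to sign, so both entries must be integers.\<close>
    have "heis_mat 1 0 0 \<in> conj_set heis heisenberg_int (inv\<^bsub>heis\<^esub> g)"
      "heis_mat 0 1 0 \<in> conj_set heis heisenberg_int (inv\<^bsub>heis\<^esub> g)"
      unfolding eq by (simp_all add: mem_heisenberg_int_iff)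
    then show "g $ 1 $ 2 \<in> \<int> \<and> g $ 2 $ 3 \<in> \<int>"
      unfolding mem using g by (simp add: heis_inv_entries)
  next
    note mem = mem_conj_heisenberg_int_iff[OF heis.inv_closed[OF g]]
    assume i: "g $ 1 $ 2 \<in> \<int> \<and> g $ 2 $ 3 \<in> \<int>"
    show "conj_set heis heisenberg_int (inv\<^bsub>heis\<^esub> g) = heisenberg_int"
    proof (rule Set.set_eqI)
      fix x :: "real ^ 3 ^ 3"
      define t where "t = x $ 1 $ 2 * g $ 2 $ 3 - g $ 1 $ 2 * x $ 2 $ 3"
      have t: "t \<in> \<int>" if "x $ 1 $ 2 \<in> \<int>" "x $ 2 $ 3 \<in> \<int>"
        using that i by (simp add: t_def)
      have eq: "x $ 1 $ 3 - (x $ 1 $ 2 * (- g $ 2 $ 3) - - g $ 1 $ 2 * x $ 2 $ 3) = x $ 1 $ 3 + t"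
        by (simp add: t_def)
      show "x \<in> conj_set heis heisenberg_int (inv\<^bsub>heis\<^esub> g) \<longleftrightarrow> x \<in> heisenberg_int"
        unfolding mem mem_heisenberg_int_iff heis_inv_entries[OF g] eq using g t by auto
    qed
  qed
  then show ?thesis
    using heis.mem_normalizer_iff[OF subgroup.subset[OF heisenberg_int_subgroup], of g] by blast
qed


section \<open>Indices as orders of subgroups of \<real>/\<int>\<close>

lemma frac_eq_frac_iff: "frac (x::'a::floor_ceiling) = frac y \<longleftrightarrow> x - y \<in> \<int>"
proof
  assume "frac x = frac y"
  then have "x - y = of_int (\<lfloor>x\<rfloor> - \<lfloor>y\<rfloor>)" by (simp add: frac_def algebra_simps)
  then show "x - y \<in> \<int>" by (metis Ints_of_int)
next
  assume "x - y \<in> \<int>"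
  then show "frac x = frac y" using frac_add_int_left[of "x - y" y] by simp
qed

text \<open>Fractional parts represent the subgroup of \<open>\<real>/\<int>\<close> generated by \<open>a\<close> and \<open>b\<close>.\<close>

definition frac_lattice :: "real \<Rightarrow> real \<Rightarrow> real set" where
  "frac_lattice a b = range (\<lambda>(x::int, y::int). frac (of_int x * b - a * of_int y))"

lemma frac_latticeI:
  assumes "x \<in> \<int>" "y \<in> \<int>"
  shows "frac (x * b - a * y) \<in> frac_lattice a b"
proof -
  from assms obtain k l :: int where "x = of_int k" "y = of_int l" by (meson Ints_cases)
  then show ?thesis by (auto simp: frac_lattice_def intro!: image_eqI[of _ _ "(k, l)"])
qed

text \<open>Modulo \<int>, \<phi> is a homomorphism on S with kernel A \<inter> A^g, and its image
  is the lattice because S has all of \<int>^2 as superdiagonals. This covers S = A and S = A^g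
  alike, so the two indices agree.\<close>

lemma rcosets_conj_heisenberg_int:
  assumes g: "g \<in> carrier heis"
    and S: "S = heisenberg_int \<or> S = conj_set heis heisenberg_int g"
  shows "\<exists>h. bij_betw h (rcosets\<^bsub>heis\<lparr>carrier := S\<rparr>\<^esub> (heisenberg_int \<inter> conj_set heis heisenberg_int g))
           (frac_lattice (g $ 1 $ 2) (g $ 2 $ 3))"
proof -
  let ?A = "heisenberg_int" and ?C = "conj_set heis heisenberg_int g"
  let ?a = "g $ 1 $ 2" and ?b = "g $ 2 $ 3"
  define \<phi> where "\<phi> x = x $ 1 $ 2 * ?b - ?a * x $ 2 $ 3" for x :: "real ^ 3 ^ 3"
  have C: "subgroup ?C heis"
    by (rule heis.subgroup_conj_set[OF heisenberg_int_subgroup g])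
  have subS: "subgroup S heis" using S C heisenberg_int_subgroup by blast
  have S_carrier: "x \<in> carrier heis" if "x \<in> S" for x
    using that subS by (rule subgroup.mem_carrier[rotated])
  have C_iff: "x \<in> ?C \<longleftrightarrow> x \<in> carrier heis \<and> x $ 1 $ 2 \<in> \<int> \<and> x $ 2 $ 3 \<in> \<int> \<and>
      x $ 1 $ 3 - \<phi> x \<in> \<int>" for x
    unfolding \<phi>_def by (rule mem_conj_heisenberg_int_iff[OF g])
  have S_iff: "x \<in> ?A \<inter> ?C \<longleftrightarrow> \<phi> x \<in> \<int>" if "x \<in> S" for x
    using S
  proof
    assume "S = ?A"
    with that show ?thesis by (simp add: C_iff mem_heisenberg_int_iff)
  next
    assume "S = ?C"
    with that have C: "x \<in> ?C" by simp
    then have "x $ 1 $ 3 - \<phi> x \<in> \<int>" by (simp add: C_iff)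
    \<comment> \<open>In A^g the corner agrees with \<phi> x modulo \<int>, so it is integral
      exactly if \<phi> x is.\<close>
    then have "x $ 1 $ 3 \<in> \<int> \<longleftrightarrow> \<phi> x \<in> \<int>"
      using Ints_diff[of "x $ 1 $ 3" "x $ 1 $ 3 - \<phi> x"] Ints_add[of "x $ 1 $ 3 - \<phi> x" "\<phi> x"] by auto
    with C show ?thesis by (simp add: C_iff mem_heisenberg_int_iff)
  qed
  have "\<exists>h. bij_betw h (rcosets\<^bsub>heis\<lparr>carrier := S\<rparr>\<^esub> (?A \<inter> ?C)) ((\<lambda>x. frac (\<phi> x)) ` S)"
  proof (rule heis.subgroup_rcosets_bij_image[OF subS])
    show "subgroup (?A \<inter> ?C) heis"
      by (rule heis.subgroups_Inter_pair[OF heisenberg_int_subgroup C])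
    show "?A \<inter> ?C \<subseteq> S" using S by blast
    fix x y assume xy: "x \<in> S" "y \<in> S"
    then have "x \<otimes>\<^bsub>heis\<^esub> inv\<^bsub>heis\<^esub> y \<in> S"
      using subgroup.m_closed[OF subS] subgroup.m_inv_closed[OF subS] by blast
    then have "x \<otimes>\<^bsub>heis\<^esub> inv\<^bsub>heis\<^esub> y \<in> ?A \<inter> ?C \<longleftrightarrow> \<phi> (x \<otimes>\<^bsub>heis\<^esub> inv\<^bsub>heis\<^esub> y) \<in> \<int>"
      by (rule S_iff)
    also have "\<phi> (x \<otimes>\<^bsub>heis\<^esub> inv\<^bsub>heis\<^esub> y) = \<phi> x - \<phi> y"
      using xy[THEN S_carrier] by (simp add: \<phi>_def heis_mult_entries heis_inv_entries algebra_simps)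
    finally show "frac (\<phi> x) = frac (\<phi> y) \<longleftrightarrow> x \<otimes>\<^bsub>heis\<^esub> inv\<^bsub>heis\<^esub> y \<in> ?A \<inter> ?C"
      by (simp add: frac_eq_frac_iff)
  qed
  moreover have "(\<lambda>x. frac (\<phi> x)) ` S = frac_lattice ?a ?b"
  proof (intro equalityI subsetI)
    fix t assume "t \<in> (\<lambda>x. frac (\<phi> x)) ` S"
    then obtain x where x: "x \<in> S" "t = frac (\<phi> x)" by blast
    have "x $ 1 $ 2 \<in> \<int>" "x $ 2 $ 3 \<in> \<int>"
      using x(1) S by (auto simp: mem_heisenberg_int_iff mem_conj_heisenberg_int_iff[OF g])
    then show "t \<in> frac_lattice ?a ?b" unfolding x(2) \<phi>_def by (rule frac_latticeI)
  next
    fix t assume "t \<in> frac_lattice ?a ?b"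
    then obtain k l :: int where t: "t = frac (of_int k * ?b - ?a * of_int l)"
      by (auto simp: frac_lattice_def)
    \<comment> \<open>To realize (k, l) as a superdiagonal in S, the corner 0 will do in A, while in
      A^g the corner has to equal \<phi> of the matrix up to an integer.\<close>
    define c where "c = (if S = ?A then 0 else of_int k * ?b - ?a * of_int l)"
    have "heis_mat (of_int k) (of_int l) c \<in> S"
      using S by (auto simp: c_def mem_heisenberg_int_iff mem_conj_heisenberg_int_iff[OF g])
    then show "t \<in> (\<lambda>x. frac (\<phi> x)) ` S"
      by (rule rev_image_eqI) (simp add: t \<phi>_def)
  qed
  ultimately show ?thesis by simp
qed

text \<open>The value 0 could also stand for an infinite index. For n > 0 the lattice is finite, so
  both index conditions of the commensurizer hold at once.\<close>

lemma mem_commensurizer_index_heisenberg_iff: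
  assumes "n \<noteq> 0"
  shows "g \<in> commensurizer_index n heisenberg_int heis \<longleftrightarrow>
           g \<in> carrier heis \<and> card (frac_lattice (g $ 1 $ 2) (g $ 2 $ 3)) = n"
proof (cases "g \<in> carrier heis")
  case True
  let ?I = "heisenberg_int \<inter> conj_set heis heisenberg_int g"
  let ?L = "frac_lattice (g $ 1 $ 2) (g $ 2 $ 3)"
  have fin: "has_finite_index heis S ?I \<longleftrightarrow> finite ?L"
    if "S = heisenberg_int \<or> S = conj_set heis heisenberg_int g" for S
    using rcosets_conj_heisenberg_int[OF True that]
    unfolding has_finite_index_def by (metis bij_betw_finite)
  have "subgroup_index heis heisenberg_int ?I = card ?L"
    using rcosets_conj_heisenberg_int[OF True, of heisenberg_int]
    unfolding subgroup_index_def by (metis bij_betw_same_card)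
  then show ?thesis
    using True fin assms card_ge_0_finite[of ?L]
    by (auto simp: commensurizer_index_def commensurizer_def)
qed (auto simp: commensurizer_index_def commensurizer_def)

section \<open>Pairs generating a subgroup of order n of \<real>/\<int>\<close>

text \<open>Modulo n the numerators x j - i y run over the subgroup generated by i and j, which is
  everything since i, j and n have no common factor.\<close>

lemma frac_lattice_rational:
  fixes i j :: int and n :: nat
  assumes n: "n > 0" and gcd: "coprime i (gcd j (int n))"
  shows "frac_lattice (of_int i / real n) (of_int j / real n) = (\<lambda>k. real k / real n) ` {..<n}"
proof (intro equalityI subsetI)
  have fr: "frac (real_of_int m / real n) = real (nat (m mod int n)) / real n" for m
  proof -
    have "real_of_int m = real_of_int (m div int n) * real n + real_of_int (m mod int n)"
      by (metis div_mult_mod_eq of_int_add of_int_mult of_int_of_nat_eq)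
    then have "real_of_int m / real n = real_of_int (m div int n) + real_of_int (m mod int n) / real n"
      using n by (simp add: field_simps)
    moreover have "0 \<le> m mod int n" "m mod int n < int n" using n by simp_all
    moreover have "frac (real_of_int (m mod int n) / real n) = real_of_int (m mod int n) / real n"
      using calculation(2,3) n of_int_less_iff[of "m mod int n" "int n", where 'a = real]
      by (simp add: frac_eq)
    ultimately show ?thesis by simp
  qed
  have comb: "of_int x * (of_int j / real n) - of_int i / real n * of_int y =
      real_of_int (x * j - i * y) / real n" for x y
    by (simp add: field_simps flip: diff_divide_distrib)
  {
    fix t assume "t \<in> frac_lattice (of_int i / real n) (of_int j / real n)"
    then obtain x y :: int where
      "t = frac (of_int x * (of_int j / real n) - of_int i / real n * of_int y)"
      by (auto simp: frac_lattice_def)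
    then have "t = real (nat ((x * j - i * y) mod int n)) / real n" by (simp only: comb fr)
    moreover have "nat ((x * j - i * y) mod int n) < n" using n by (simp add: nat_less_iff)
    ultimately show "t \<in> (\<lambda>k. real k / real n) ` {..<n}" by blast
  next
    fix t assume "t \<in> (\<lambda>k. real k / real n) ` {..<n}"
    then obtain k where k: "k < n" "t = real k / real n" by blast
    \<comment> \<open>Two Bezout identities together write 1 as a combination of i, j and n; scaled
      by k, they give x and y with x j - i y congruent to k modulo n.\<close>
    obtain u v where uv: "u * j + v * int n = gcd j (int n)" by (metis bezout_int)
    obtain s w where sw: "s * i + w * gcd j (int n) = 1" using gcd by (metis bezout_int coprime_imp_gcd_eq_1)
    have "s * i + w * (u * j + v * int n) = 1" using sw uv by simp
    then have "int k * (s * i + w * (u * j + v * int n)) = int k" by simp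
    then have "(int k * w * u) * j - i * (- int k * s) = int k + int n * (- int k * w * v)"
      by (simp add: algebra_simps)
    then have "((int k * w * u) * j - i * (- int k * s)) mod int n = int k"
      using k by (metis mod_mult_self2 mod_pos_pos_trivial of_nat_0_le_iff of_nat_less_iff)
    then have "t = frac (of_int (int k * w * u) * (of_int j / real n) - of_int i / real n * of_int (- int k * s))"
      unfolding comb fr using k by simp
    then show "t \<in> frac_lattice (of_int i / real n) (of_int j / real n)"
      by (simp only:) (rule frac_latticeI; rule Ints_of_int)
  }
qed

lemma card_frac_lattice_rational:
  fixes i j :: int and n :: nat
  assumes "n > 0" "coprime i (gcd j (int n))"
  shows "card (frac_lattice (of_int i / real n) (of_int j / real n)) = n"
  using assms by (simp add: frac_lattice_rational card_image inj_on_def)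

text \<open>By the pigeonhole principle, k a and l a differ by an integer for some k \<noteq>
  l.\<close>

lemma finite_range_frac_multiples_imp_Rats:
  fixes a :: real
  assumes "finite (range (\<lambda>k::int. frac (of_int k * a)))"
  shows "a \<in> \<rat>"
proof -
  have "\<not> inj (\<lambda>k::int. frac (of_int k * a))"
    using assms finite_imageD infinite_UNIV_int by blast
  then obtain k l :: int where kl: "k \<noteq> l" "frac (of_int k * a) = frac (of_int l * a)"
    by (auto simp: inj_def)
  then have "(of_int k - of_int l) * a \<in> \<int>" by (simp add: frac_eq_frac_iff left_diff_distrib)
  then obtain m :: int where "(of_int k - of_int l) * a = of_int m" by (auto elim: Ints_cases)
  then have "a = of_int m / of_int (k - l)" using kl by (simp add: field_simps)
  then show ?thesis by simp
qed

text \<open>Over the denominator q s it suffices to cancel the common factor of both numerators and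
  the denominator; the two fractions need not be reduced separately.\<close>

lemma Rats_common_denominator:
  fixes a b :: real
  assumes "a \<in> \<rat>" "b \<in> \<rat>"
  obtains i j :: int and n :: nat where "n > 0" "coprime i (gcd j (int n))"
    "a = of_int i / real n" "b = of_int j / real n"
proof -
  obtain p :: int and q :: nat where a: "q > 0" "a = of_int p / real q"
    using assms(1) unfolding Rats_eq_int_div_nat by blast
  obtain r :: int and s :: nat where b: "s > 0" "b = of_int r / real s"
    using assms(2) unfolding Rats_eq_int_div_nat by blast
  define d where "d = gcd (p * int s) (gcd (r * int q) (int (q * s)))"
  have d: "d > 0" using a b by (simp add: d_def gcd_pos_int)
  obtain i j m where ijm: "p * int s = d * i" "r * int q = d * j" "int (q * s) = d * m"
  proof -
    have "d dvd p * int s" "d dvd r * int q" "d dvd int (q * s)"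
      unfolding d_def by (auto intro: dvd_trans[OF gcd_dvd2])
    then show ?thesis using that by (auto elim!: dvdE)
  qed
  have m: "m > 0"
  proof -
    have "d * m > 0" using a b by (simp flip: ijm(3))
    with d show ?thesis by (simp add: zero_less_mult_iff)
  qed
  have "d * gcd i (gcd j m) = d"
    using d d_def unfolding ijm by (simp add: gcd_mult_left)
  then have "coprime i (gcd j (int (nat m)))" using d m by (simp add: coprime_iff_gcd_eq_1)
  moreover have "real q * real s = of_int d * of_int m"
    using ijm(3) by (metis of_int_mult of_int_of_nat_eq of_nat_mult)
  moreover have "of_int p * real s = of_int d * of_int i"
    using ijm(1) by (metis of_int_mult of_int_of_nat_eq)
  moreover have "of_int r * real q = of_int d * of_int j"
    using ijm(2) by (metis of_int_mult of_int_of_nat_eq)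
  moreover have "a = (of_int p * real s) / (real q * real s)" "b = (of_int r * real q) / (real q * real s)"
    using a b by simp_all
  ultimately show ?thesis
    using that[of "nat m" i j] m d by simp
qed

text \<open>Finiteness of the subgroup forces a and b to be rational. Their least common denominator
  is then the order of the subgroup, hence n.\<close>

lemma card_frac_lattice_eq_iff:
  assumes n: "n > 0"
  shows "card (frac_lattice a b) = n \<longleftrightarrow>
    (\<exists>i j. coprime i (gcd j (int n)) \<and> a = of_int i / real n \<and> b = of_int j / real n)"
proof
  assume card: "card (frac_lattice a b) = n"
  then have fin: "finite (frac_lattice a b)" using n by (simp add: card_ge_0_finite)
  \<comment> \<open>The coefficient pairs (k, 0) and (0, -k) give the multiples of b and of
    a.\<close>
  have "frac (of_int k * b) \<in> frac_lattice a b" "frac (of_int k * a) \<in> frac_lattice a b" for k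
    using frac_latticeI[of "of_int k" 0 b a] frac_latticeI[of 0 "- of_int k" b a]
    by (simp_all add: mult.commute)
  then have "a \<in> \<rat>" "b \<in> \<rat>"
    by (auto intro!: finite_range_frac_multiples_imp_Rats finite_subset[OF _ fin])
  then obtain i j m where m: "m > 0" "coprime i (gcd j (int m))"
    "a = of_int i / real m" "b = of_int j / real m"
    by (rule Rats_common_denominator)
  with card card_frac_lattice_rational[OF m(1,2)] have "m = n" by simp
  from m(2-4) show "\<exists>i j. coprime i (gcd j (int n)) \<and> a = of_int i / real n \<and> b = of_int j / real n"
    unfolding \<open>m = n\<close> by metis
qed (use n card_frac_lattice_rational in auto)

section \<open>Orbits of the normalizer and their number\<close>

text \<open>These turn out to be the orbits of the normalizer: it contains matrices with any corner,
  so only the superdiagonal modulo \<int> survives.\<close>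

definition heis_class :: "real \<Rightarrow> real \<Rightarrow> (real ^ 3 ^ 3) set" where
  "heis_class a b = {x \<in> carrier heis. x $ 1 $ 2 - a \<in> \<int> \<and> x $ 2 $ 3 - b \<in> \<int>}"

lemma heis_normalizer_orbit:
  assumes g: "g \<in> carrier heis"
  shows "orbit (heis\<lparr>carrier := normalizer heis heisenberg_int\<rparr>) (\<lambda>h g. h \<otimes>\<^bsub>heis\<^esub> g) g =
    heis_class (g $ 1 $ 2) (g $ 2 $ 3)" (is "?O = ?R")
proof (intro equalityI subsetI)
  fix x assume "x \<in> ?O"
  then show "x \<in> ?R"
    using g by (auto simp: orbit_def mem_normalizer_heisenberg_int_iff heis_mult_entries heis_class_def)
next
  fix x assume "x \<in> ?R"
  then have x: "x \<in> carrier heis" "x $ 1 $ 2 - g $ 1 $ 2 \<in> \<int>" "x $ 2 $ 3 - g $ 2 $ 3 \<in> \<int>"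
    by (auto simp: heis_class_def)
  let ?h = "x \<otimes>\<^bsub>heis\<^esub> inv\<^bsub>heis\<^esub> g"
  have "?h \<in> normalizer heis heisenberg_int"
    using x g by (simp add: mem_normalizer_heisenberg_int_iff heis_mult_entries heis_inv_entries)
  moreover have "x = ?h \<otimes>\<^bsub>heis\<^esub> g" using x g by (simp add: heis.m_assoc)
  ultimately show "x \<in> ?O" unfolding orbit_def by auto
qed

lemma heis_class_eq_iff: "heis_class a b = heis_class c d \<longleftrightarrow> a - c \<in> \<int> \<and> b - d \<in> \<int>"
proof
  assume eq: "heis_class a b = heis_class c d"
  have "heis_mat a b 0 \<in> heis_class a b" by (simp add: heis_class_def)
  then show "a - c \<in> \<int> \<and> b - d \<in> \<int>" unfolding eq by (simp add: heis_class_def)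
next
  assume d: "a - c \<in> \<int> \<and> b - d \<in> \<int>"
  have "y - a \<in> \<int> \<longleftrightarrow> y - c \<in> \<int>" if "a - c \<in> \<int>" for y a c :: real
    using Ints_add[OF _ that, of "y - a"] Ints_diff[OF _ that, of "y - c"] by auto
  with d show "heis_class a b = heis_class c d" unfolding heis_class_def by blast
qed

lemma comm_quotient_heisenberg_eq:
  assumes n: "n > 0"
  shows "comm_quotient n heisenberg_int heis =
    (\<lambda>(a, b). heis_class a b) ` {(a, b). card (frac_lattice a b) = n}"
proof (intro equalityI subsetI)
  fix X assume "X \<in> comm_quotient n heisenberg_int heis"
  then obtain g where g: "g \<in> commensurizer_index n heisenberg_int heis"
    "X = orbit (heis\<lparr>carrier := normalizer heis heisenberg_int\<rparr>) (\<lambda>h g. h \<otimes>\<^bsub>heis\<^esub> g) g"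
    by (auto simp: comm_quotient_def orbits_def)
  from g(1) n have "g \<in> carrier heis" "card (frac_lattice (g $ 1 $ 2) (g $ 2 $ 3)) = n"
    by (simp_all add: mem_commensurizer_index_heisenberg_iff)
  then show "X \<in> (\<lambda>(a, b). heis_class a b) ` {(a, b). card (frac_lattice a b) = n}"
    by (auto simp: g(2) heis_normalizer_orbit)
next
  fix X assume "X \<in> (\<lambda>(a, b). heis_class a b) ` {(a, b). card (frac_lattice a b) = n}"
  then obtain a b where ab: "card (frac_lattice a b) = n" "X = heis_class a b" by auto
  have "heis_mat a b 0 \<in> commensurizer_index n heisenberg_int heis"
    using n ab(1) by (simp add: mem_commensurizer_index_heisenberg_iff)
  moreover have "X = orbit (heis\<lparr>carrier := normalizer heis heisenberg_int\<rparr>)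
      (\<lambda>h g. h \<otimes>\<^bsub>heis\<^esub> g) (heis_mat a b 0)"
    by (simp add: heis_normalizer_orbit ab(2))
  ultimately show "X \<in> comm_quotient n heisenberg_int heis"
    unfolding comm_quotient_def orbits_def by blast
qed

text \<open>Every class has exactly one representative (i/n, j/n) in the unit square [0,1)^2, and
  reducing numerators modulo n keeps their common gcd with n.\<close>

lemma comm_quotient_heisenberg_bij:
  assumes n: "n > 0"
  shows "bij_betw (\<lambda>(i, j). heis_class (real i / real n) (real j / real n))
    (primitive_pairs n) (comm_quotient n heisenberg_int heis)" (is "bij_betw ?f _ _")
proof (rule bij_betw_imageI)
  show "?f ` primitive_pairs n = comm_quotient n heisenberg_int heis"
  proof (intro equalityI subsetI)
    fix X assume "X \<in> ?f ` primitive_pairs n"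
    then obtain i j where ij: "coprime i (gcd j n)" and X: "X = ?f (i, j)"
      by (auto simp: primitive_pairs_def)
    have "coprime (int i) (gcd (int j) (int n))"
      using ij by (simp only: gcd_int_int_eq coprime_int_iff)
    from card_frac_lattice_rational[OF n this] X
    show "X \<in> comm_quotient n heisenberg_int heis"
      by (auto simp: comm_quotient_heisenberg_eq[OF n])
  next
    fix X assume "X \<in> comm_quotient n heisenberg_int heis"
    then obtain a b where "card (frac_lattice a b) = n" and X: "X = heis_class a b"
      by (auto simp: comm_quotient_heisenberg_eq[OF n])
    then obtain i j where ij: "coprime i (gcd j (int n))" "a = of_int i / real n" "b = of_int j / real n"
      unfolding card_frac_lattice_eq_iff[OF n] by metis
    define i' j' where "i' = nat (i mod int n)" and "j' = nat (j mod int n)"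
    have i': "int i' = i mod int n" "i' < n" and j': "int j' = j mod int n" "j' < n"
      using n by (simp_all add: i'_def j'_def nat_less_iff)
    have red: "gcd (k mod int n) (int n) = gcd k (int n)" for k
      by (metis gcd.commute gcd_red_int)
    have "int (gcd i' (gcd j' n)) = gcd (i mod int n) (gcd (j mod int n) (int n))"
      by (simp only: gcd_int_int_eq[symmetric] i' j')
    also have "\<dots> = gcd j (gcd (i mod int n) (int n))"
      by (simp only: red gcd.left_commute)
    also have "\<dots> = gcd i (gcd j (int n))"
      by (simp only: red gcd.left_commute)
    finally have "(i', j') \<in> primitive_pairs n"
      using ij(1) i' j' by (simp add: primitive_pairs_def coprime_iff_gcd_eq_1)
    moreover have "of_int k / real n - real k' / real n \<in> \<int>" if "int k' = k mod int n" for k k'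
    proof -
      have "real_of_int k = real_of_int (k div int n) * real n + real k'"
        by (metis that div_mult_mod_eq of_int_add of_int_mult of_int_of_nat_eq)
      then have "of_int k / real n - real k' / real n = of_int (k div int n)"
        using n by (simp add: field_simps)
      then show ?thesis by simp
    qed
    then have "X = ?f (i', j')" using i'(1) j'(1) by (simp add: X ij heis_class_eq_iff)
    ultimately show "X \<in> ?f ` primitive_pairs n" by blast
  qed
  \<comment> \<open>Both fractions lie in [0,1), where a number is its own fractional part.\<close>
  have "r = s" if "r < n" "s < n" "real r / real n - real s / real n \<in> \<int>" for r s :: nat
  proof -
    have "frac (real r / real n) = frac (real s / real n)"
      using that(3) by (simp only: frac_eq_frac_iff)
    moreover have "frac (real r / real n) = real r / real n" "frac (real s / real n) = real s / real n"
      using that by (simp_all add: frac_eq)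
    ultimately show "r = s" using n by simp
  qed
  then show "inj_on ?f (primitive_pairs n)"
    by (auto simp: inj_on_def primitive_pairs_def heis_class_eq_iff)
qed

theorem theorem1p1:
  shows "(\<forall>n\<ge>1. finite (comm_quotient n heisenberg_int (heisenberg :: (real ^ 3 ^ 3) monoid))) \<and>
         (\<lambda>n. real (comm_count_upto n heisenberg_int (heisenberg :: (real ^ 3 ^ 3) monoid)) / real n ^ 3)
           \<longlonglongrightarrow> 1 / (3 * riemann_zeta 3)"
proof
  \<comment> \<open>Finiteness ensures that the values of \<open>comm_count\<close> are genuine and
    not the default 0 of infinite sets.\<close>
  show "\<forall>n\<ge>1. finite (comm_quotient n heisenberg_int heis)"
    using bij_betw_finite[OF comm_quotient_heisenberg_bij] finite_primitive_pairs by simp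
  have "comm_count n heisenberg_int heis = card (primitive_pairs n)" if "n > 0" for n
    unfolding comm_count_def using bij_betw_same_card[OF comm_quotient_heisenberg_bij[OF that]] by simp
  then have "comm_count_upto n heisenberg_int heis = (\<Sum>k=1..n. card (primitive_pairs k))" for n
    unfolding comm_count_upto_def by (intro sum.cong) simp_all
  \<comment> \<open>\<open>powr\<close> with the numeral exponent 3 is the ordinary cube, so the two
    series agree term by term.\<close>
  moreover have "riemann_zeta 3 = (\<Sum>k. 1 / real (Suc k) ^ 3)"
    unfolding riemann_zeta_def by (simp only: powr_numeral of_nat_0_le_iff)
  ultimately show "(\<lambda>n. real (comm_count_upto n heisenberg_int heis) / real n ^ 3)
      \<longlonglongrightarrow> 1 / (3 * riemann_zeta 3)"
    using primitive_pairs_asymptotics by (simp only: divide_divide_eq_left)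
qed

end
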